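(* Let $F,G:\Omega\to\mathcal{H}$ be Bessel mappings for $\mathcal{H}$ with respect to $(\Omega,\mu)$ and let either $F$ or $G$ be norm bounded. Let $m:\Omega\to\mathbb{C}$ be an (essentially) bounded measurable function that vanishes at infinity, i.e. for every $\varepsilon>0$ there is a (measurable) set $K=K(\varepsilon)\subseteq\Omega$ of finite measure, $\mu(K)<\infty$, such that $|m(\omega)|\le\varepsilon$ for almost every $\omega\in\Omega\setminus K$. Then $\mathbf{M}_{m,F,G}$ is a compact operator on $\mathcal{H}$.
   Context: $\mathcal{H}$ is a complex Hilbert space with inner product linear in the first and conjugate linear in the second variable, and $(\Omega,\mu)$ is a measure space with positive measure $\mu$. A mapping $F:\Omega\to\mathcal{H}$ is a Bessel mapping with respect to $(\Omega,\mu)$ with Bessel bound $B_F$ if $\omega\mapsto\langle f,F(\omega)\rangle$ is measurable for every $f\in\mathcal{H}$ and $\int_\Omega|\langle f,F(\omega)\rangle|^2\,d\mu(\omega)\le B_F\|f\|^2$ for all $f\in\mathcal{H}$. It is norm bounded if there is a constant $M>0$ with $\|F(\omega)\|\le M$ for almost every $\omega\in\Omega$. For Bessel mappings $F,G$ and measurable $m:\Omega\to\mathbb{C}$, the continuous Bessel multiplier $\mathbf{M}_{m,F,G}:\mathcal{H}\to\mathcal{H}$ with symbol $m$ is the operator weakly defined by $\langle\mathbf{M}_{m,F,G}f,g\rangle=\int_\Omega m(\omega)\langle f,F(\omega)\rangle\langle G(\omega),g\rangle\,d\mu(\omega)$ for all $f,g\in\mathcal{H}$. *)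

theory Defs
  imports "HOL-Analysis.Analysis"
begin

(* A complex Hilbert space as a type: a Banach space whose real scalar multiplication
   extends to a complex one and whose norm comes from a complex inner product, which is
   linear in the first and conjugate linear in the second argument. Definiteness of the
   inner product follows from cnorm_eq_sqrt_cinner. *)
class complex_hilbert_space = banach +
  fixes scaleC :: "complex \<Rightarrow> 'a \<Rightarrow> 'a"
    and cinner :: "'a \<Rightarrow> 'a \<Rightarrow> complex"
  assumes scaleC_add_right: "scaleC c (x + y) = scaleC c x + scaleC c y"
    and scaleC_add_left: "scaleC (c + d) x = scaleC c x + scaleC d x"
    and scaleC_scaleC: "scaleC c (scaleC d x) = scaleC (c * d) x"
    and scaleC_of_real: "scaleC (complex_of_real r) x = scaleR r x"
    and cinner_add_left: "cinner (x + y) z = cinner x z + cinner y z"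
    and cinner_scaleC_left: "cinner (scaleC c x) y = c * cinner x y"
    and cinner_commute: "cinner x y = cnj (cinner y x)"
    and cinner_self_nonneg: "0 \<le> Re (cinner x x)"
    and cnorm_eq_sqrt_cinner: "norm x = sqrt (Re (cinner x x))"

instantiation complex :: complex_hilbert_space
begin

definition scaleC_complex :: "complex \<Rightarrow> complex \<Rightarrow> complex"
  where "scaleC_complex c x = c * x"

definition cinner_complex :: "complex \<Rightarrow> complex \<Rightarrow> complex"
  where "cinner_complex x y = x * cnj y"

instance
proof
  fix c d x y z :: complex and r :: real
  show "scaleC c (x + y) = scaleC c x + scaleC c y"
    and "scaleC (c + d) x = scaleC c x + scaleC d x"
    and "scaleC c (scaleC d x) = scaleC (c * d) x"
    by (simp_all add: scaleC_complex_def algebra_simps)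
  show "scaleC (complex_of_real r) x = scaleR r x"
    by (simp only: scaleC_complex_def scaleR_conv_of_real)
  show "cinner (x + y) z = cinner x z + cinner y z"
    and "cinner (scaleC c x) y = c * cinner x y"
    and "cinner x y = cnj (cinner y x)"
    by (simp_all add: scaleC_complex_def cinner_complex_def algebra_simps)
  show "0 \<le> Re (cinner x x)"
    by (simp add: cinner_complex_def)
  show "norm x = sqrt (Re (cinner x x))"
    by (simp add: cinner_complex_def cmod_def power2_eq_square)
qed

end

definition compact_operator ::
  "('h::complex_hilbert_space \<Rightarrow> 'h) \<Rightarrow> bool"
  where "compact_operator T \<longleftrightarrow>
    (\<forall>x y. T (x + y) = T x + T y) \<and>
    (\<forall>c x. T (scaleC c x) = scaleC c (T x)) \<and>
    (\<forall>S. bounded S \<longrightarrow> compact (closure (T ` S)))"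

(* The integral is taken in [0, \<infinity>], so the bound includes its finiteness.
   0 \<le> B is required because ennreal truncates negative reals to 0. *)
definition bessel_mapping_with_bound ::
  "'w measure \<Rightarrow> ('w \<Rightarrow> 'h::complex_hilbert_space) \<Rightarrow> real \<Rightarrow> bool"
  where "bessel_mapping_with_bound \<mu> F B \<longleftrightarrow>
    0 \<le> B \<and>
    (\<forall>f. (\<lambda>\<omega>. cinner f (F \<omega>)) \<in> borel_measurable \<mu>) \<and>
    (\<forall>f. (\<integral>\<^sup>+\<omega>. ennreal ((cmod (cinner f (F \<omega>)))\<^sup>2) \<partial>\<mu>) \<le> ennreal (B * (norm f)\<^sup>2))"

definition bessel_mapping ::
  "'w measure \<Rightarrow> ('w \<Rightarrow> 'h::complex_hilbert_space) \<Rightarrow> bool"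
  where "bessel_mapping \<mu> F \<longleftrightarrow> (\<exists>B. bessel_mapping_with_bound \<mu> F B)"

definition norm_bounded ::
  "'w measure \<Rightarrow> ('w \<Rightarrow> 'h::complex_hilbert_space) \<Rightarrow> bool"
  where "norm_bounded \<mu> F \<longleftrightarrow> (\<exists>M>0. AE \<omega> in \<mu>. norm (F \<omega>) \<le> M)"

definition essentially_bounded :: "'w measure \<Rightarrow> ('w \<Rightarrow> complex) \<Rightarrow> bool"
  where "essentially_bounded \<mu> m \<longleftrightarrow> (\<exists>C. AE \<omega> in \<mu>. cmod (m \<omega>) \<le> C)"

definition vanishes_at_infinity :: "'w measure \<Rightarrow> ('w \<Rightarrow> complex) \<Rightarrow> bool"
  where "vanishes_at_infinity \<mu> m \<longleftrightarrow>
    (\<forall>\<epsilon>>0. \<exists>K\<in>sets \<mu>. emeasure \<mu> K < \<infinity> \<and>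
      (AE \<omega> in \<mu>. \<omega> \<notin> K \<longrightarrow> cmod (m \<omega>) \<le> \<epsilon>))"

definition weakly_defines_multiplier ::
  "'w measure \<Rightarrow> ('w \<Rightarrow> complex) \<Rightarrow> ('w \<Rightarrow> 'h::complex_hilbert_space) \<Rightarrow> ('w \<Rightarrow> 'h)
    \<Rightarrow> ('h \<Rightarrow> 'h) \<Rightarrow> bool"
  where "weakly_defines_multiplier \<mu> m F G T \<longleftrightarrow>
    (\<forall>f g. cinner (T f) g =
      (LINT \<omega>|\<mu>. m \<omega> * cinner f (F \<omega>) * cinner (G \<omega>) g))"

definition bessel_multiplier ::
  "'w measure \<Rightarrow> ('w \<Rightarrow> complex) \<Rightarrow> ('w \<Rightarrow> 'h::complex_hilbert_space) \<Rightarrow> ('w \<Rightarrow> 'h)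
    \<Rightarrow> 'h \<Rightarrow> 'h"
  where "bessel_multiplier \<mu> m F G = (THE T. weakly_defines_multiplier \<mu> m F G T)"

lemma cinner_left_ext:
  fixes x y :: "'h::complex_hilbert_space"
  assumes "\<And>z. cinner x z = cinner y z"
  shows "x = y"
proof -
  have "cinner (x - y) z = 0" for z
    using cinner_add_left[of "x - y" y z] assms[of z] by simp
  then have "norm (x - y) = 0"
    by (simp add: cnorm_eq_sqrt_cinner)
  then show ?thesis by simp
qed

lemma weakly_defines_multiplier_unique:
  assumes "weakly_defines_multiplier \<mu> m F G S" "weakly_defines_multiplier \<mu> m F G T"
  shows "S = T"
proof
  fix f
  show "S f = T f"
    by (rule cinner_left_ext) (use assms in \<open>simp add: weakly_defines_multiplier_def\<close>)
qed

lemma bessel_multiplier_eqI: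
  assumes "weakly_defines_multiplier \<mu> m F G T"
  shows "bessel_multiplier \<mu> m F G = T"
  unfolding bessel_multiplier_def
  by (rule the_equality[where P = "weakly_defines_multiplier \<mu> m F G", OF assms])
    (rule weakly_defines_multiplier_unique[OF _ assms])

end

theory Submission
  imports Defs
begin

text \<open>
  Write \<open>\<Phi> f g\<close> for the integral that weakly defines the multiplier. Cauchy--Schwarz in
  \<open>L\<^sup>2(\<mu>)\<close> and the Bessel bounds make \<open>\<Phi>\<close> a bounded sesquilinear form, so the Riesz
  representation theorem (\<open>riesz_conjugate_linear_functional\<close>) yields the operator.

  Compactness rests on a Hilbert--Schmidt argument. Suppose that \<open>norm (F \<omega>) \<le> M\<close> almost everywhere, let \<open>K\<close> have
  finite measure and let \<open>q f\<close> be the \<open>L\<^sup>2\<close> norm over \<open>K\<close> of \<open>\<omega> \<mapsto> cinner f (F \<omega>)\<close>. By Bessel's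
  inequality applied at each \<open>\<omega>\<close>, the sum of \<open>(q e)\<^sup>2\<close> over any finite orthonormal set is at
  most \<open>M\<^sup>2 \<mu>(K)\<close>. Only a bounded number of orthonormal vectors can therefore satisfy
  \<open>q e > \<delta>\<close>, and on the orthogonal complement of a maximal such set \<open>E\<close> one has
  \<open>q f \<le> \<delta> * norm f\<close> (\<open>small_off_finite_orthonormal_set\<close>). Choosing \<open>K\<close> such that the symbol is
  small off \<open>K\<close>, one obtains \<open>cmod (\<Phi> f g) \<le> \<epsilon> * norm f * norm g\<close> whenever \<open>f\<close> is
  orthogonal to \<open>E\<close>. If instead \<open>G\<close> is norm bounded, exchanging the roles of \<open>F\<close> and \<open>G\<close>
  and conjugating \<open>\<Phi>\<close> gives the same estimate for \<open>g\<close> orthogonal to \<open>E\<close>.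

  With \<open>P\<close> the orthogonal projection onto the span of \<open>E\<close>, the operator \<open>T\<close> is thus within
  \<open>\<epsilon>\<close> of the finite-rank operator \<open>T P\<close> in the first case and of \<open>P T\<close> in the second. So
  the image of a bounded set is totally bounded
  (\<open>compact_operator_if_small_off_finite_orthonormal_sets\<close>).
\<close>

section \<open>Complex inner product geometry\<close>

lemma cinner_add_right: "cinner x (y + z) = cinner x y + cinner x z"
  by (metis cinner_add_left cinner_commute complex_cnj_add)

lemma cinner_scaleC_right: "cinner x (scaleC c y) = cnj c * cinner x y"
  by (metis cinner_commute cinner_scaleC_left complex_cnj_mult)

lemma cinner_zero_left [simp]: "cinner 0 y = 0"
  by (metis add_cancel_right_left cinner_add_left)

lemma cinner_zero_right [simp]: "cinner x 0 = 0"
  by (metis add_cancel_right_left cinner_add_right)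

lemma cinner_minus_left: "cinner (- x) y = - cinner x y"
  by (metis add.right_inverse add_eq_0_iff cinner_add_left cinner_zero_left)

lemma cinner_minus_right: "cinner x (- y) = - cinner x y"
  by (metis cinner_commute cinner_minus_left complex_cnj_minus)

lemma cinner_diff_left: "cinner (x - y) z = cinner x z - cinner y z"
  using cinner_add_left[of x "- y" z] by (simp add: cinner_minus_left)

lemma cinner_sum_left: "cinner (\<Sum>i\<in>I. x i) y = (\<Sum>i\<in>I. cinner (x i) y)"
  by (induction I rule: infinite_finite_induct) (simp_all add: cinner_add_left)

lemma cinner_sum_right: "cinner x (\<Sum>i\<in>I. y i) = (\<Sum>i\<in>I. cinner x (y i))"
  by (induction I rule: infinite_finite_induct) (simp_all add: cinner_add_right)

lemma cinner_scaleR_left: "cinner (r *\<^sub>R x) y = of_real r * cinner x y"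
  by (metis cinner_scaleC_left scaleC_of_real)

lemma cinner_scaleR_right: "cinner x (r *\<^sub>R y) = of_real r * cinner x y"
  by (metis cinner_scaleC_right complex_cnj_complex_of_real scaleC_of_real)

lemma cinner_self: "cinner x x = of_real ((norm x)\<^sup>2)"
proof -
  have "Im (cinner x x) = 0"
    using cinner_commute[of x x] by (metis Reals_cnj_iff complex_is_Real_iff)
  then show ?thesis
    by (simp add: complex_eq_iff cnorm_eq_sqrt_cinner cinner_self_nonneg)
qed

lemma cmod_cinner_commute: "cmod (cinner x y) = cmod (cinner y x)"
  by (metis cinner_commute complex_mod_cnj)

lemma norm_scaleC: "norm (scaleC c x) = cmod c * norm x"
proof -
  have "complex_of_real ((norm (scaleC c x))\<^sup>2) = (c * cnj c) * cinner x x"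
    unfolding cinner_self[symmetric] by (simp add: cinner_scaleC_left cinner_scaleC_right)
  also have "\<dots> = of_real ((cmod c * norm x)\<^sup>2)"
    by (simp only: cinner_self complex_norm_square[symmetric] power_mult_distrib of_real_mult)
  finally have "complex_of_real ((norm (scaleC c x))\<^sup>2) = of_real ((cmod c * norm x)\<^sup>2)" .
  then have "(norm (scaleC c x))\<^sup>2 = (cmod c * norm x)\<^sup>2"
    using of_real_eq_iff by blast
  then show ?thesis
    by (simp add: power2_eq_iff_nonneg)
qed

lemma norm_add_squared: "(norm (x + y))\<^sup>2 = (norm x)\<^sup>2 + 2 * Re (cinner x y) + (norm y)\<^sup>2"
proof -
  have "Re (cinner y x) = Re (cinner x y)"
    by (subst cinner_commute) simp
  moreover have "(norm (x + y))\<^sup>2 = Re (cinner (x + y) (x + y))"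
    by (simp only: cinner_self Re_complex_of_real)
  ultimately show ?thesis
    by (simp only: cinner_add_left cinner_add_right) (simp add: cinner_self)
qed

definition orthonormal_set :: "'h::complex_hilbert_space set \<Rightarrow> bool"
  where "orthonormal_set E \<longleftrightarrow>
    (\<forall>e\<in>E. norm e = 1) \<and> (\<forall>e\<in>E. \<forall>e'\<in>E. e \<noteq> e' \<longrightarrow> cinner e e' = 0)"

definition orthogonal_to :: "'h::complex_hilbert_space set \<Rightarrow> 'h \<Rightarrow> bool"
  where "orthogonal_to E f \<longleftrightarrow> (\<forall>e\<in>E. cinner f e = 0)"

definition orthonormal_proj :: "'h::complex_hilbert_space set \<Rightarrow> 'h \<Rightarrow> 'h"
  where "orthonormal_proj E f = (\<Sum>e\<in>E. scaleC (cinner f e) e)"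

lemma orthogonal_to_residual:
  assumes "finite E" "orthonormal_set E"
  shows "orthogonal_to E (f - orthonormal_proj E f)"
  unfolding orthogonal_to_def
proof
  fix e assume e: "e \<in> E"
  have "cinner (orthonormal_proj E f) e = (\<Sum>d\<in>E. cinner f d * cinner d e)"
    by (simp add: orthonormal_proj_def cinner_sum_left cinner_scaleC_left)
  also have "\<dots> = (\<Sum>d\<in>E. if d = e then cinner f e else 0)"
    using assms(2) e by (intro sum.cong) (auto simp: orthonormal_set_def cinner_self)
  also have "\<dots> = cinner f e"
    using assms(1) e by simp
  finally show "cinner (f - orthonormal_proj E f) e = 0"
    by (simp add: cinner_diff_left)
qed

lemma cinner_orthonormal_proj_orthogonal:
  assumes "orthogonal_to E f"
  shows "cinner f (orthonormal_proj E g) = 0"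
  using assms
  by (simp add: orthogonal_to_def orthonormal_proj_def cinner_sum_right cinner_scaleC_right)

text \<open>The residual is orthogonal to the projection, whose squared norm is the sum on the right.\<close>
lemma pythagoras_orthonormal_proj:
  assumes "finite E" "orthonormal_set E"
  shows "(norm f)\<^sup>2 = (norm (f - orthonormal_proj E f))\<^sup>2 + (\<Sum>e\<in>E. (cmod (cinner f e))\<^sup>2)"
proof -
  let ?P = "orthonormal_proj E f"
  have orth: "cinner (f - ?P) ?P = 0"
    by (intro cinner_orthonormal_proj_orthogonal orthogonal_to_residual assms)
  then have "complex_of_real ((norm ?P)\<^sup>2) = cinner f ?P"
    unfolding cinner_self[symmetric] by (simp add: cinner_diff_left)
  also have "\<dots> = (\<Sum>e\<in>E. cnj (cinner f e) * cinner f e)"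
    by (simp add: orthonormal_proj_def cinner_sum_right cinner_scaleC_right)
  also have "\<dots> = of_real (\<Sum>e\<in>E. (cmod (cinner f e))\<^sup>2)"
    unfolding of_real_sum by (intro sum.cong) (simp_all only: complex_norm_square mult.commute)
  finally have "(norm ?P)\<^sup>2 = (\<Sum>e\<in>E. (cmod (cinner f e))\<^sup>2)"
    using of_real_eq_iff by blast
  then show ?thesis
    using norm_add_squared[of "f - ?P" ?P] orth by simp
qed

lemma bessel_inequality:
  assumes "finite E" "orthonormal_set E"
  shows "(\<Sum>e\<in>E. (cmod (cinner f e))\<^sup>2) \<le> (norm f)\<^sup>2"
  using pythagoras_orthonormal_proj[OF assms, of f] by simp

lemma norm_residual_le:
  assumes "finite E" "orthonormal_set E"
  shows "norm (f - orthonormal_proj E f) \<le> norm f"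
proof (rule power2_le_imp_le)
  show "(norm (f - orthonormal_proj E f))\<^sup>2 \<le> (norm f)\<^sup>2"
    using pythagoras_orthonormal_proj[OF assms, of f]
    by (simp add: sum_nonneg)
qed simp

text \<open>The Cauchy--Schwarz inequality is Bessel's inequality for a single normalised vector.\<close>
lemma cmod_cinner_le: "cmod (cinner x y) \<le> norm x * norm y"
proof (cases "y = 0")
  case False
  define e where "e = (1 / norm y) *\<^sub>R y"
  have "(cmod (cinner x e))\<^sup>2 \<le> (norm x)\<^sup>2"
    using bessel_inequality[of "{e}" x] False by (simp add: e_def orthonormal_set_def)
  then have "cmod (cinner x e) \<le> norm x"
    by (simp add: power2_le_iff_abs_le)
  then show ?thesis
    using False by (simp add: e_def cinner_scaleR_right norm_divide field_simps)
qed simp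

section \<open>Riesz representation\<close>

text \<open>
  The representing vector minimises \<open>J x = (norm x)\<^sup>2 - 2 * \<psi> x\<close>. By the parallelogram law a
  minimising sequence is Cauchy, so completeness provides a minimiser \<open>y\<close>, and the vanishing of
  the derivative of \<open>J\<close> at \<open>y\<close> in direction \<open>x\<close> is the equation \<open>Re (cinner y x) = \<psi> x\<close>.
\<close>
lemma riesz_real_functional:
  fixes \<psi> :: "'h::complex_hilbert_space \<Rightarrow> real"
  assumes lin: "linear \<psi>" and bnd: "\<And>x. \<bar>\<psi> x\<bar> \<le> K * norm x"
  obtains y where "\<And>x. Re (cinner y x) = \<psi> x"
proof -
  interpret linear \<psi> by fact
  define J where "J x = (norm x)\<^sup>2 - 2 * \<psi> x" for x
  define d where "d = Inf (range J)"
  have J_lower: "- K\<^sup>2 \<le> J x" for x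
  proof -
    have "0 \<le> (norm x - K)\<^sup>2" by simp
    then have "- K\<^sup>2 \<le> (norm x)\<^sup>2 - 2 * (K * norm x)"
      by (simp add: power2_eq_square algebra_simps)
    then show ?thesis using bnd[of x] by (simp add: J_def)
  qed
  then have bdd: "bdd_below (range J)" by (auto intro!: bdd_belowI)
  have d_le: "d \<le> J x" for x
    unfolding d_def by (rule cInf_lower[OF _ bdd]) simp
  have "\<exists>x. J x < d + 1 / Suc n" for n
  proof -
    have "Inf (range J) < d + 1 / Suc n" by (simp add: d_def)
    then show ?thesis using cInf_lessD[of "range J"] by blast
  qed
  then obtain X where X: "\<And>n. J (X n) < d + 1 / Suc n" by metis
  have par: "(norm (x - y))\<^sup>2 = 2 * (J x + J y) - 4 * J ((1/2) *\<^sub>R (x + y))" for x y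
  proof -
    have "(norm ((1/2) *\<^sub>R (x + y)))\<^sup>2 = (norm (x + y))\<^sup>2 / 4"
      by (simp add: power_divide)
    moreover have "\<psi> ((1/2) *\<^sub>R (x + y)) = (\<psi> x + \<psi> y) / 2"
      unfolding scale add by simp
    moreover have "(norm (x - y))\<^sup>2 = (norm x)\<^sup>2 - 2 * Re (cinner x y) + (norm y)\<^sup>2"
      using norm_add_squared[of x "- y"] by (simp add: cinner_minus_right)
    ultimately show ?thesis
      using norm_add_squared[of x y] unfolding J_def by argo
  qed
  have "Cauchy X"
  proof (rule metric_CauchyI)
    fix e :: real assume "0 < e"
    then obtain N where N: "1 / real (Suc N) < e\<^sup>2 / 4"
      using nat_approx_posE[of "e\<^sup>2/4"] by auto
    define u where "u k = 1 / real (Suc k)" for k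
    have "dist (X i) (X j) < e" if "N \<le> i" "N \<le> j" for i j
    proof -
      have le: "u k \<le> u N" if "N \<le> k" for k
        using that by (simp add: u_def field_simps)
      have "(norm (X i - X j))\<^sup>2 \<le> 2 * (J (X i) + J (X j)) - 4 * d"
        using par[of "X i" "X j"] d_le[of "(1/2) *\<^sub>R (X i + X j)"] by linarith
      also have "\<dots> < 2 * u i + 2 * u j"
        using X[of i, folded u_def] X[of j, folded u_def] by argo
      also have "\<dots> \<le> 4 * u N"
        using le[OF that(1)] le[OF that(2)] by linarith
      also have "\<dots> < e\<^sup>2" using N unfolding u_def[symmetric] by linarith
      finally show ?thesis
        using \<open>0 < e\<close> by (simp add: dist_norm power_less_imp_less_base)
    qed
    then show "\<exists>M. \<forall>m\<ge>M. \<forall>n\<ge>M. dist (X m) (X n) < e" by blast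
  qed
  then obtain y where y: "X \<longlonglongrightarrow> y"
    using Cauchy_convergent convergent_def by blast
  have "bounded_linear \<psi>"
    by (rule bounded_linear_intro[where K = K]) (use bnd in \<open>auto simp: add scale mult.commute\<close>)
  from bounded_linear.tendsto[OF this y] have "(\<lambda>n. J (X n)) \<longlonglongrightarrow> J y"
    unfolding J_def by (intro tendsto_intros y)
  moreover have "(\<lambda>n. d + 1 / real (Suc n)) \<longlonglongrightarrow> d + 0"
    by (intro tendsto_intros LIMSEQ_inverse_real_of_nat[unfolded inverse_eq_divide])
  ultimately have Jy: "J y \<le> d"
    using LIMSEQ_le[of "\<lambda>n. J (X n)" "J y" "\<lambda>n. d + 1 / real (Suc n)" d] X
    by (auto simp: less_imp_le)
  have "Re (cinner y x) = \<psi> x" for x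
  proof (rule ccontr)
    assume ne: "Re (cinner y x) \<noteq> \<psi> x"
    define a where "a = Re (cinner y x) - \<psi> x"
    define b where "b = (norm x)\<^sup>2 + 1"
    have "b > 0" by (simp add: b_def add_nonneg_pos)
    (* The derivative of J at y in direction x is 2 a. The step -a/b minimises an upper bound of
       the parabola t \<mapsto> J (y + t x); the summand 1 keeps b positive when x = 0. *)
    define t where "t = - a / b"
    have "J (y + t *\<^sub>R x) = J y + 2 * t * a + t\<^sup>2 * (norm x)\<^sup>2"
      using norm_add_squared[of y "t *\<^sub>R x"]
      by (simp add: J_def a_def add scale cinner_scaleR_right power_mult_distrib algebra_simps)
    also have "\<dots> \<le> J y + 2 * t * a + t\<^sup>2 * b"
      by (simp add: b_def mult_left_mono)
    also have "\<dots> = J y - a\<^sup>2 / b"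
      using \<open>b > 0\<close> by (simp add: t_def power2_eq_square field_simps)
    also have "\<dots> < J y"
      using \<open>b > 0\<close> ne by (simp add: a_def)
    finally show False using Jy d_le[of "y + t *\<^sub>R x"] by linarith
  qed
  then show ?thesis using that by blast
qed

text \<open>
  Representing the real part suffices: evaluating it at \<open>\<i> x\<close> recovers the imaginary part.
\<close>
lemma riesz_conjugate_linear_functional:
  fixes \<phi> :: "'h::complex_hilbert_space \<Rightarrow> complex"
  assumes add: "\<And>x y. \<phi> (x + y) = \<phi> x + \<phi> y"
    and scale: "\<And>c x. \<phi> (scaleC c x) = cnj c * \<phi> x"
    and bnd: "\<And>x. cmod (\<phi> x) \<le> K * norm x"
  shows "\<exists>y. \<forall>x. cinner y x = \<phi> x"
proof -
  have "linear (\<lambda>x. Re (\<phi> x))"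
    by (rule linearI) (simp_all add: add scale flip: scaleC_of_real)
  moreover have "\<bar>Re (\<phi> x)\<bar> \<le> K * norm x" for x
    using abs_Re_le_cmod bnd by (rule order_trans)
  ultimately obtain y where y: "\<And>x. Re (cinner y x) = Re (\<phi> x)"
    using riesz_real_functional[of "\<lambda>x. Re (\<phi> x)" K] by blast
  have "Im (cinner y x) = Im (\<phi> x)" for x
    using y[of "scaleC \<i> x"] by (simp add: scale cinner_scaleC_right)
  with y have "cinner y x = \<phi> x" for x by (simp add: complex_eq_iff)
  then show ?thesis by blast
qed

section \<open>Compactness from finite orthonormal sets\<close>

text \<open>
  The function \<open>q\<close> stands for \<open>f \<mapsto> norm (A f)\<close> with \<open>A\<close> a Hilbert--Schmidt operator, and
  \<open>D\<close> bounds its squared Hilbert--Schmidt norm. An orthonormal set on which \<open>q\<close> exceeds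
  \<open>\<delta>\<close> has at most \<open>D / \<delta>\<^sup>2\<close> elements; a largest one is the required \<open>E\<close>, since a
  vector orthogonal to \<open>E\<close> that violates the bound could be normalised and added to it.
\<close>
lemma small_off_finite_orthonormal_set:
  fixes q :: "'h::complex_hilbert_space \<Rightarrow> real"
  assumes hom: "\<And>r x. q (r *\<^sub>R x) = \<bar>r\<bar> * q x"
    and trace: "\<And>E. finite E \<Longrightarrow> orthonormal_set E \<Longrightarrow> (\<Sum>e\<in>E. (q e)\<^sup>2) \<le> D"
    and "\<delta> > 0"
  obtains E where "finite E" "orthonormal_set E" "\<And>f. orthogonal_to E f \<Longrightarrow> q f \<le> \<delta> * norm f"
proof -
  define \<E> where "\<E> = {E. finite E \<and> orthonormal_set E \<and> (\<forall>e\<in>E. \<delta> < q e)}"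
  have card_le: "card E \<le> nat \<lfloor>D / \<delta>\<^sup>2\<rfloor>" if "E \<in> \<E>" for E
  proof -
    have "real (card E) * \<delta>\<^sup>2 = (\<Sum>e\<in>E. \<delta>\<^sup>2)" by simp
    also have "\<dots> \<le> (\<Sum>e\<in>E. (q e)\<^sup>2)"
      using that \<open>\<delta> > 0\<close> by (intro sum_mono power_mono) (auto simp: \<E>_def less_imp_le)
    also have "\<dots> \<le> D" using that trace by (auto simp: \<E>_def)
    finally have "real (card E) \<le> D / \<delta>\<^sup>2" using \<open>\<delta> > 0\<close> by (simp add: field_simps)
    then show ?thesis by (simp add: le_nat_floor)
  qed
  have "{} \<in> \<E>" by (simp add: \<E>_def orthonormal_set_def)
  then obtain E where E: "E \<in> \<E>" and max: "\<And>E'. E' \<in> \<E> \<Longrightarrow> card E' \<le> card E"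
    using ex_has_greatest_nat[of "\<lambda>E. E \<in> \<E>" "{}" card] card_le
    by (metis less_Suc_eq_le)
  have "q f \<le> \<delta> * norm f" if orth: "orthogonal_to E f" for f
  proof (rule ccontr)
    assume "\<not> q f \<le> \<delta> * norm f"
    then have big: "\<delta> * norm f < q f" by simp
    moreover have "q 0 = 0" using hom[of 0 0] by simp
    ultimately have "f \<noteq> 0" by auto
    define u where "u = (1 / norm f) *\<^sub>R f"
    have u: "norm u = 1" "\<delta> < q u"
      using big \<open>f \<noteq> 0\<close> by (simp_all add: u_def hom field_simps)
    have u_orth: "cinner u e = 0" "cinner e u = 0" if "e \<in> E" for e
    proof -
      show "cinner u e = 0"
        using that orth by (simp add: u_def cinner_scaleR_left orthogonal_to_def)
      then show "cinner e u = 0" by (metis cinner_commute complex_cnj_zero)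
    qed
    have "u \<notin> E"
      using u_orth(1)[of u] u(1) by (auto simp: cinner_self)
    have "insert u E \<in> \<E>"
      using E u u_orth by (auto simp: \<E>_def orthonormal_set_def)
    from max[OF this] show False
      using E \<open>u \<notin> E\<close> by (simp add: \<E>_def)
  qed
  then show ?thesis using that E by (auto simp: \<E>_def)
qed

text \<open>
  The family need not be linearly independent, since the set is obtained as a continuous image
  of a product of discs, one index at a time.
\<close>
lemma compact_bounded_combinations:
  fixes v :: "'i \<Rightarrow> 'h::complex_hilbert_space"
  assumes "finite I"
  shows "compact {(\<Sum>i\<in>I. scaleC (c i) (v i)) | c. \<forall>i\<in>I. cmod (c i) \<le> R}"
  using assms
proof (induction I)
  case (insert j I)
  let ?S = "\<lambda>I. {(\<Sum>i\<in>I. scaleC (c i) (v i)) | c. \<forall>i\<in>I. cmod (c i) \<le> R}"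
  have "bounded_linear (\<lambda>c. scaleC c (v j))"
  proof (rule bounded_linear_intro[where K = "norm (v j)"])
    fix r c
    show "scaleC (r *\<^sub>R c) (v j) = r *\<^sub>R scaleC c (v j)"
      by (simp only: scaleR_conv_of_real scaleC_scaleC[symmetric] scaleC_of_real)
  qed (simp_all add: scaleC_add_left norm_scaleC)
  then have "continuous_on (cball 0 R \<times> ?S I) (\<lambda>z. scaleC (fst z) (v j) + snd z)"
    by (intro continuous_on_add bounded_linear.continuous_on[where f = "\<lambda>c. scaleC c (v j)"]
        continuous_on_fst continuous_on_snd continuous_on_id)
  then have "compact ((\<lambda>z. scaleC (fst z) (v j) + snd z) ` (cball 0 R \<times> ?S I))"
    by (intro compact_continuous_image compact_Times insert.IH compact_cball)
  also have "(\<lambda>z. scaleC (fst z) (v j) + snd z) ` (cball 0 R \<times> ?S I) = ?S (insert j I)"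
  proof (intro equalityI subsetI)
    fix z assume "z \<in> (\<lambda>z. scaleC (fst z) (v j) + snd z) ` (cball 0 R \<times> ?S I)"
    then obtain a c where "cmod a \<le> R" "\<forall>i\<in>I. cmod (c i) \<le> R"
      "z = scaleC a (v j) + (\<Sum>i\<in>I. scaleC (c i) (v i))"
      by auto
    moreover have "(\<Sum>i\<in>I. scaleC (c i) (v i)) = (\<Sum>i\<in>I. scaleC ((c(j := a)) i) (v i))"
      using insert.hyps by (intro sum.cong) auto
    ultimately have "z = (\<Sum>i\<in>insert j I. scaleC ((c(j := a)) i) (v i)) \<and>
        (\<forall>i\<in>insert j I. cmod ((c(j := a)) i) \<le> R)"
      using insert.hyps by auto
    then show "z \<in> ?S (insert j I)" by blast
  next
    fix z assume "z \<in> ?S (insert j I)"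
    then obtain c where "\<forall>i\<in>insert j I. cmod (c i) \<le> R"
      "z = (\<Sum>i\<in>insert j I. scaleC (c i) (v i))" by blast
    then show "z \<in> (\<lambda>z. scaleC (fst z) (v j) + snd z) ` (cball 0 R \<times> ?S I)"
      using insert.hyps by (intro image_eqI[where x = "(c j, \<Sum>i\<in>I. scaleC (c i) (v i))"]) auto
  qed
  finally show ?case .
qed simp

lemma compact_closure_if_near_compact:
  fixes A :: "'a::complete_space set"
  assumes "\<And>\<epsilon>. \<epsilon> > 0 \<Longrightarrow> \<exists>C. compact C \<and> (\<forall>x\<in>A. \<exists>y\<in>C. dist x y \<le> \<epsilon>)"
  shows "compact (closure A)"
  unfolding compact_eq_totally_bounded
proof (intro conjI allI impI)
  show "complete (closure A)" by (simp add: complete_eq_closed)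
  fix \<epsilon> :: real assume "\<epsilon> > 0"
  then obtain C where C: "compact C" "\<And>x. x \<in> A \<Longrightarrow> \<exists>y\<in>C. dist x y \<le> \<epsilon>/4"
    using assms[of "\<epsilon>/4"] by auto
  obtain k where k: "finite k" "C \<subseteq> (\<Union>x\<in>k. ball x (\<epsilon>/4))"
    using C(1) \<open>\<epsilon> > 0\<close> unfolding compact_eq_totally_bounded
    by (metis zero_less_divide_iff zero_less_numeral)
  have "closure A \<subseteq> (\<Union>x\<in>k. ball x \<epsilon>)"
  proof
    fix a assume "a \<in> closure A"
    then obtain x where x: "x \<in> A" "dist x a < \<epsilon>/4"
      using \<open>\<epsilon> > 0\<close> unfolding closure_approachable
      by (metis zero_less_divide_iff zero_less_numeral)
    obtain y where y: "y \<in> C" "dist x y \<le> \<epsilon>/4" using C(2) x(1) by blast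
    obtain z where z: "z \<in> k" "dist z y < \<epsilon>/4" using k(2) y(1) by auto
    have "dist z a \<le> dist z y + dist y a" by (rule dist_triangle)
    also have "dist y a \<le> dist x y + dist x a" by (rule dist_triangle3)
    finally have "dist z a < \<epsilon>" using x y z \<open>\<epsilon> > 0\<close> by linarith
    with z(1) show "a \<in> (\<Union>x\<in>k. ball x \<epsilon>)" by auto
  qed
  with k(1) show "\<exists>k. finite k \<and> closure A \<subseteq> (\<Union>x\<in>k. ball x \<epsilon>)" by blast
qed

lemma norm_le_if_cinner_le:
  assumes "0 \<le> c" and "\<And>g. cmod (cinner x g) \<le> c * norm g"
  shows "norm x \<le> c"
proof (cases "x = 0")
  case False
  have "norm x * norm x \<le> c * norm x"
    using assms(2)[of x] by (simp add: cinner_self norm_mult power2_eq_square)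
  then show ?thesis using False by simp
qed (use assms in simp)

text \<open>
  The two alternatives are the smallness of \<open>T (1 - P)\<close> and of \<open>(1 - P) T\<close>, where \<open>P\<close>
  projects onto the span of \<open>E\<close>. The second one replaces the passage to the adjoint of \<open>T\<close>.
\<close>
lemma compact_operator_if_small_off_finite_orthonormal_sets:
  fixes T :: "'h::complex_hilbert_space \<Rightarrow> 'h"
  assumes add: "\<And>x y. T (x + y) = T x + T y"
    and scale: "\<And>c x. T (scaleC c x) = scaleC c (T x)"
    and bnd: "\<And>f g. cmod (cinner (T f) g) \<le> L * norm f * norm g"
    and small: "\<And>\<epsilon>. \<epsilon> > 0 \<Longrightarrow> \<exists>E. finite E \<and> orthonormal_set E \<and>
      ((\<forall>f g. orthogonal_to E f \<longrightarrow> cmod (cinner (T f) g) \<le> \<epsilon> * norm f * norm g) \<or>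
       (\<forall>f g. orthogonal_to E g \<longrightarrow> cmod (cinner (T f) g) \<le> \<epsilon> * norm f * norm g))"
  shows "compact_operator T"
  unfolding compact_operator_def
proof (intro conjI allI impI add scale)
  fix S :: "'h set" assume "bounded S"
  then obtain R where "R > 0" and R: "\<And>f. f \<in> S \<Longrightarrow> norm f \<le> R"
    by (auto simp: bounded_pos)
  have T_diff: "T (x - y) = T x - T y" for x y
    using add[of "x - y" y] by simp
  have T_0: "T 0 = 0"
    using T_diff[of 0 0] by simp
  have T_sum: "T (\<Sum>i\<in>I. x i) = (\<Sum>i\<in>I. T (x i))" for I :: "'h set" and x
    by (induction I rule: infinite_finite_induct) (simp_all add: add T_0)
  show "compact (closure (T ` S))"
  proof (rule compact_closure_if_near_compact)
    fix \<epsilon> :: real assume "\<epsilon> > 0"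
    then have "\<epsilon> / R > 0" using \<open>R > 0\<close> by simp
    then obtain E where E: "finite E" "orthonormal_set E" and
      cases: "(\<forall>f g. orthogonal_to E f \<longrightarrow> cmod (cinner (T f) g) \<le> \<epsilon>/R * norm f * norm g) \<or>
        (\<forall>f g. orthogonal_to E g \<longrightarrow> cmod (cinner (T f) g) \<le> \<epsilon>/R * norm f * norm g)"
      using small by blast
    have coeff: "cmod (cinner f e) \<le> norm f" if "e \<in> E" for f e
      using cmod_cinner_le[of f e] that E(2) by (auto simp: orthonormal_set_def)
    have scaled: "\<epsilon>/R * t \<le> \<epsilon>" if "t \<le> R" for t
      using that \<open>R > 0\<close> \<open>\<epsilon> > 0\<close> by (simp add: field_simps)
    from cases show "\<exists>C. compact C \<and> (\<forall>x\<in>T ` S. \<exists>y\<in>C. dist x y \<le> \<epsilon>)"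
    proof
      assume near: "\<forall>f g. orthogonal_to E f \<longrightarrow> cmod (cinner (T f) g) \<le> \<epsilon>/R * norm f * norm g"
      let ?C = "{(\<Sum>e\<in>E. scaleC (c e) (T e)) | c. \<forall>e\<in>E. cmod (c e) \<le> R}"
      have "\<exists>y\<in>?C. dist (T f) y \<le> \<epsilon>" if f: "f \<in> S" for f
      proof
        let ?y = "T (orthonormal_proj E f)"
        have "?y = (\<Sum>e\<in>E. scaleC (cinner f e) (T e))"
          by (simp add: orthonormal_proj_def T_sum scale)
        then show "?y \<in> ?C"
          using coeff[of _ f] R[OF f] order_trans by blast
        let ?r = "f - orthonormal_proj E f"
        have r_le: "norm ?r \<le> R"
          using norm_residual_le[OF E, of f] R[OF f] by linarith
        have "norm (T ?r) \<le> \<epsilon>/R * norm ?r"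
        proof (rule norm_le_if_cinner_le)
          show "0 \<le> \<epsilon>/R * norm ?r" using \<open>\<epsilon> > 0\<close> \<open>R > 0\<close> by simp
        qed (use near orthogonal_to_residual[OF E] in blast)
        also have "\<dots> \<le> \<epsilon>" by (rule scaled) (rule r_le)
        finally show "dist (T f) ?y \<le> \<epsilon>" by (simp add: dist_norm T_diff)
      qed
      moreover have "compact ?C" by (rule compact_bounded_combinations[OF E(1)])
      ultimately show ?thesis by blast
    next
      assume near: "\<forall>f g. orthogonal_to E g \<longrightarrow> cmod (cinner (T f) g) \<le> \<epsilon>/R * norm f * norm g"
      (* Coefficients of T f are bounded by its norm; max 0 guards against a negative L, which the
         bound on the form permits in the zero space. *)
      let ?C = "{(\<Sum>e\<in>E. scaleC (c e) e) | c. \<forall>e\<in>E. cmod (c e) \<le> max 0 L * R}"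
      have "\<exists>y\<in>?C. dist (T f) y \<le> \<epsilon>" if f: "f \<in> S" for f
      proof
        let ?y = "orthonormal_proj E (T f)"
        have "norm (T f) \<le> max 0 L * norm f"
        proof (rule norm_le_if_cinner_le)
          fix g :: 'h
          have "L * norm f * norm g \<le> max 0 L * norm f * norm g"
            by (intro mult_right_mono) auto
          then show "cmod (cinner (T f) g) \<le> max 0 L * norm f * norm g"
            using bnd[of f g] by linarith
        qed simp
        also have "\<dots> \<le> max 0 L * R"
          using R[OF f] by (intro mult_left_mono) auto
        finally have "\<forall>e\<in>E. cmod (cinner (T f) e) \<le> max 0 L * R"
          using coeff[of _ "T f"] order_trans by blast
        then show "?y \<in> ?C"
          unfolding orthonormal_proj_def by blast
        let ?r = "T f - ?y"
        have orth: "orthogonal_to E ?r" by (rule orthogonal_to_residual[OF E])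
        have "cinner ?y ?r = 0"
          by (metis cinner_commute cinner_orthonormal_proj_orthogonal complex_cnj_zero orth)
        then have "complex_of_real ((norm ?r)\<^sup>2) = cinner (T f) ?r"
          by (metis cinner_diff_left cinner_self diff_zero)
        then have "(norm ?r)\<^sup>2 = cmod (cinner (T f) ?r)"
          by (metis norm_of_real abs_of_nonneg zero_le_power2)
        also have "\<dots> \<le> \<epsilon>/R * norm f * norm ?r"
          using near orth by blast
        also have "\<dots> \<le> \<epsilon> * norm ?r"
          by (intro mult_right_mono scaled R[OF f]) simp
        finally have "norm ?r * norm ?r \<le> \<epsilon> * norm ?r"
          by (simp only: power2_eq_square)
        then have "norm ?r \<le> \<epsilon>"
          using \<open>\<epsilon> > 0\<close> by (cases "norm ?r = 0") auto
        then show "dist (T f) ?y \<le> \<epsilon>" by (simp only: dist_norm)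
      qed
      moreover have "compact ?C" by (rule compact_bounded_combinations[OF E(1)])
      ultimately show ?thesis by blast
    qed
  qed
qed

section \<open>Integral estimates for multipliers\<close>

lemma Cauchy_Schwarz_weighted_integral:
  fixes a b m :: "'w \<Rightarrow> complex"
  assumes [measurable]: "m \<in> borel_measurable \<mu>" "a \<in> borel_measurable \<mu>" "b \<in> borel_measurable \<mu>"
    and a2: "integrable \<mu> (\<lambda>\<omega>. (cmod (a \<omega>))\<^sup>2)"
    and b2: "integrable \<mu> (\<lambda>\<omega>. (cmod (b \<omega>))\<^sup>2)"
    and m_le: "AE \<omega> in \<mu>. cmod (m \<omega>) \<le> C" and "0 \<le> C"
  shows "integrable \<mu> (\<lambda>\<omega>. m \<omega> * a \<omega> * b \<omega>)"
    and "cmod (LINT \<omega>|\<mu>. m \<omega> * a \<omega> * b \<omega>) \<le>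
      C * sqrt (LINT \<omega>|\<mu>. (cmod (a \<omega>))\<^sup>2) * sqrt (LINT \<omega>|\<mu>. (cmod (b \<omega>))\<^sup>2)"
proof -
  let ?A = "LINT \<omega>|\<mu>. (cmod (a \<omega>))\<^sup>2" and ?B = "LINT \<omega>|\<mu>. (cmod (b \<omega>))\<^sup>2"
  let ?I = "\<integral>\<^sup>+\<omega>. ennreal (cmod (a \<omega>)) * ennreal (cmod (b \<omega>)) \<partial>\<mu>"
  have sq: "?I\<^sup>2 \<le> (ennreal (sqrt ?A * sqrt ?B))\<^sup>2"
  proof -
    have "?I\<^sup>2 \<le> (\<integral>\<^sup>+\<omega>. (ennreal (cmod (a \<omega>)))\<^sup>2 \<partial>\<mu>) * (\<integral>\<^sup>+\<omega>. (ennreal (cmod (b \<omega>)))\<^sup>2 \<partial>\<mu>)"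
      by (rule Cauchy_Schwarz_nn_integral) measurable
    also have "\<dots> = ennreal ?A * ennreal ?B"
      using nn_integral_eq_integral[OF a2] nn_integral_eq_integral[OF b2]
      by (simp add: ennreal_power)
    also have "\<dots> = (ennreal (sqrt ?A * sqrt ?B))\<^sup>2"
      by (simp add: ennreal_power power_mult_distrib ennreal_mult)
    finally show ?thesis .
  qed
  have I_le: "?I \<le> ennreal (sqrt ?A * sqrt ?B)"
  proof (cases ?I)
    case (real r)
    have "r\<^sup>2 \<le> (sqrt ?A * sqrt ?B)\<^sup>2"
      using sq unfolding real(2) using real(1) by (simp add: ennreal_power)
    then show ?thesis
      unfolding real(2) by (intro ennreal_leI power2_le_imp_le[of r]) simp_all
  next
    case top
    with sq show ?thesis by (simp add: ennreal_power top_unique)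
  qed
  have "(\<integral>\<^sup>+\<omega>. norm (m \<omega> * a \<omega> * b \<omega>) \<partial>\<mu>)
      \<le> (\<integral>\<^sup>+\<omega>. ennreal C * (ennreal (cmod (a \<omega>)) * ennreal (cmod (b \<omega>))) \<partial>\<mu>)"
  proof (rule nn_integral_mono_AE)
    show "AE \<omega> in \<mu>. ennreal (norm (m \<omega> * a \<omega> * b \<omega>))
      \<le> ennreal C * (ennreal (cmod (a \<omega>)) * ennreal (cmod (b \<omega>)))"
      using m_le
    proof eventually_elim
      case (elim \<omega>)
      then have "norm (m \<omega> * a \<omega> * b \<omega>) \<le> C * (cmod (a \<omega>) * cmod (b \<omega>))"
        by (simp add: norm_mult mult.assoc mult_right_mono)
      then show ?case
        using \<open>0 \<le> C\<close> by (simp flip: ennreal_mult add: ennreal_leI)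
    qed
  qed
  also have "\<dots> = ennreal C * ?I" by (rule nn_integral_cmult) measurable
  also have "\<dots> \<le> ennreal C * ennreal (sqrt ?A * sqrt ?B)"
    by (intro mult_left_mono I_le) simp
  also have "\<dots> = ennreal (C * sqrt ?A * sqrt ?B)"
    using \<open>0 \<le> C\<close> by (simp flip: ennreal_mult add: mult.assoc)
  finally have le: "(\<integral>\<^sup>+\<omega>. norm (m \<omega> * a \<omega> * b \<omega>) \<partial>\<mu>) \<le> ennreal (C * sqrt ?A * sqrt ?B)" .
  show int: "integrable \<mu> (\<lambda>\<omega>. m \<omega> * a \<omega> * b \<omega>)"
  proof (rule integrableI_bounded)
    show "(\<integral>\<^sup>+\<omega>. ennreal (norm (m \<omega> * a \<omega> * b \<omega>)) \<partial>\<mu>) < \<infinity>"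
      using le by (rule order_le_less_trans) simp
  qed measurable
  have "ennreal (cmod (LINT \<omega>|\<mu>. m \<omega> * a \<omega> * b \<omega>)) \<le> ennreal (C * sqrt ?A * sqrt ?B)"
    by (rule order_trans[OF integral_norm_bound_ennreal[OF int] le])
  then show "cmod (LINT \<omega>|\<mu>. m \<omega> * a \<omega> * b \<omega>) \<le> C * sqrt ?A * sqrt ?B"
    using \<open>0 \<le> C\<close> by (subst (asm) ennreal_le_iff) simp_all
qed

lemma borel_measurable_cnj:
  assumes "f \<in> borel_measurable M"
  shows "(\<lambda>x. cnj (f x)) \<in> borel_measurable M"
  by (rule measurable_compose[OF assms])
    (intro borel_measurable_continuous_onI continuous_on_cnj continuous_on_id)

lemma bessel_coefficient_measurable:
  assumes "bessel_mapping_with_bound \<mu> F B"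
  shows "(\<lambda>\<omega>. cinner f (F \<omega>)) \<in> borel_measurable \<mu>"
    and "(\<lambda>\<omega>. cinner (F \<omega>) f) \<in> borel_measurable \<mu>"
proof -
  show *: "(\<lambda>\<omega>. cinner f (F \<omega>)) \<in> borel_measurable \<mu>"
    using assms by (simp add: bessel_mapping_with_bound_def)
  from borel_measurable_cnj[OF *] show "(\<lambda>\<omega>. cinner (F \<omega>) f) \<in> borel_measurable \<mu>"
    by (simp flip: cinner_commute)
qed

lemma bessel_coefficient_square_integrable:
  assumes "bessel_mapping_with_bound \<mu> F B"
  shows "integrable \<mu> (\<lambda>\<omega>. (cmod (cinner f (F \<omega>)))\<^sup>2)"
    and "(LINT \<omega>|\<mu>. (cmod (cinner f (F \<omega>)))\<^sup>2) \<le> B * (norm f)\<^sup>2"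
proof -
  have [measurable]: "(\<lambda>\<omega>. cinner f (F \<omega>)) \<in> borel_measurable \<mu>" and "0 \<le> B"
    and le: "(\<integral>\<^sup>+\<omega>. ennreal ((cmod (cinner f (F \<omega>)))\<^sup>2) \<partial>\<mu>) \<le> ennreal (B * (norm f)\<^sup>2)"
    using assms by (auto simp: bessel_mapping_with_bound_def)
  show int: "integrable \<mu> (\<lambda>\<omega>. (cmod (cinner f (F \<omega>)))\<^sup>2)"
  proof (rule integrableI_bounded)
    show "(\<integral>\<^sup>+\<omega>. ennreal (norm ((cmod (cinner f (F \<omega>)))\<^sup>2)) \<partial>\<mu>) < \<infinity>"
      using le by (simp add: order_le_less_trans)
  qed measurable
  from le have "ennreal (LINT \<omega>|\<mu>. (cmod (cinner f (F \<omega>)))\<^sup>2) \<le> ennreal (B * (norm f)\<^sup>2)"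
    by (subst (asm) nn_integral_eq_integral[OF int]) simp_all
  then show "(LINT \<omega>|\<mu>. (cmod (cinner f (F \<omega>)))\<^sup>2) \<le> B * (norm f)\<^sup>2"
    using \<open>0 \<le> B\<close> by (subst (asm) ennreal_le_iff) simp_all
qed

lemma sqrt_bessel_integral_le:
  assumes "bessel_mapping_with_bound \<mu> F B"
  shows "sqrt (LINT \<omega>|\<mu>. (cmod (cinner f (F \<omega>)))\<^sup>2) \<le> sqrt B * norm f"
  using real_sqrt_le_mono[OF bessel_coefficient_square_integrable(2)[OF assms, of f]]
  by (simp add: real_sqrt_mult)

lemma multiplier_integrand_bound:
  assumes F: "bessel_mapping_with_bound \<mu> F B\<^sub>F" and G: "bessel_mapping_with_bound \<mu> G B\<^sub>G"
    and m: "m \<in> borel_measurable \<mu>" "AE \<omega> in \<mu>. cmod (m \<omega>) \<le> C" "0 \<le> C"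
  shows "integrable \<mu> (\<lambda>\<omega>. m \<omega> * cinner f (F \<omega>) * cinner (G \<omega>) g)"
    and "cmod (LINT \<omega>|\<mu>. m \<omega> * cinner f (F \<omega>) * cinner (G \<omega>) g)
      \<le> C * (sqrt B\<^sub>F * sqrt B\<^sub>G) * norm f * norm g"
proof -
  note CS = Cauchy_Schwarz_weighted_integral[OF m(1)
      bessel_coefficient_measurable(1)[OF F] bessel_coefficient_measurable(2)[OF G]
      bessel_coefficient_square_integrable(1)[OF F]
      bessel_coefficient_square_integrable(1)[OF G, of g, unfolded cmod_cinner_commute[of g]] m(2,3)]
  show "integrable \<mu> (\<lambda>\<omega>. m \<omega> * cinner f (F \<omega>) * cinner (G \<omega>) g)"
    by (rule CS(1))
  note CS(2)
  also have "C * sqrt (LINT \<omega>|\<mu>. (cmod (cinner f (F \<omega>)))\<^sup>2) *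
      sqrt (LINT \<omega>|\<mu>. (cmod (cinner (G \<omega>) g))\<^sup>2)
    \<le> C * (sqrt B\<^sub>F * norm f) * (sqrt B\<^sub>G * norm g)"
  proof (rule mult_mono)
    show "C * sqrt (LINT \<omega>|\<mu>. (cmod (cinner f (F \<omega>)))\<^sup>2) \<le> C * (sqrt B\<^sub>F * norm f)"
      by (rule mult_left_mono[OF sqrt_bessel_integral_le[OF F] m(3)])
    show "sqrt (LINT \<omega>|\<mu>. (cmod (cinner (G \<omega>) g))\<^sup>2) \<le> sqrt B\<^sub>G * norm g"
      unfolding cmod_cinner_commute[of _ g] by (rule sqrt_bessel_integral_le[OF G])
    show "0 \<le> C * (sqrt B\<^sub>F * norm f)"
      using F m(3) by (simp add: bessel_mapping_with_bound_def)
  qed simp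
  finally show "cmod (LINT \<omega>|\<mu>. m \<omega> * cinner f (F \<omega>) * cinner (G \<omega>) g)
      \<le> C * (sqrt B\<^sub>F * sqrt B\<^sub>G) * norm f * norm g"
    by (simp add: mult_ac)
qed

text \<open>
  On a set of finite measure the analysis operator of a norm bounded Bessel mapping is
  Hilbert--Schmidt: summing over an orthonormal set under the integral and using Bessel's
  inequality at each point bounds its squared norm by the integral of \<open>M\<^sup>2\<close> over \<open>K\<close>.
\<close>
lemma bounded_bessel_mapping_small_off_finite_orthonormal_set:
  assumes F: "bessel_mapping_with_bound \<mu> F B"
    and M: "AE \<omega> in \<mu>. norm (F \<omega>) \<le> M"
    and K: "K \<in> sets \<mu>" "emeasure \<mu> K < \<infinity>"
    and "\<delta> > 0"
  obtains E where "finite E" "orthonormal_set E"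
    "\<And>f. orthogonal_to E f \<Longrightarrow>
      sqrt (LINT \<omega>|\<mu>. indicat_real K \<omega> * (cmod (cinner f (F \<omega>)))\<^sup>2) \<le> \<delta> * norm f"
proof -
  define q where "q f = sqrt (LINT \<omega>|\<mu>. indicat_real K \<omega> * (cmod (cinner f (F \<omega>)))\<^sup>2)" for f
  have int: "integrable \<mu> (\<lambda>\<omega>. indicat_real K \<omega> * (cmod (cinner f (F \<omega>)))\<^sup>2)" for f
    using integrable_mult_indicator[OF K(1) bessel_coefficient_square_integrable(1)[OF F]] by simp
  have hom: "q (r *\<^sub>R f) = \<bar>r\<bar> * q f" for r f
  proof -
    have "(LINT \<omega>|\<mu>. indicat_real K \<omega> * (cmod (cinner (r *\<^sub>R f) (F \<omega>)))\<^sup>2)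
        = (LINT \<omega>|\<mu>. r\<^sup>2 * (indicat_real K \<omega> * (cmod (cinner f (F \<omega>)))\<^sup>2))"
      by (simp add: cinner_scaleR_left norm_mult power_mult_distrib mult_ac)
    then show ?thesis by (simp add: q_def real_sqrt_mult)
  qed
  have trace: "(\<Sum>e\<in>E. (q e)\<^sup>2) \<le> (LINT \<omega>|\<mu>. indicat_real K \<omega> * M\<^sup>2)"
    if E: "finite E" "orthonormal_set E" for E
  proof -
    have "(\<Sum>e\<in>E. (q e)\<^sup>2) = (\<Sum>e\<in>E. LINT \<omega>|\<mu>. indicat_real K \<omega> * (cmod (cinner e (F \<omega>)))\<^sup>2)"
      by (simp add: q_def)
    also have "\<dots> = (LINT \<omega>|\<mu>. (\<Sum>e\<in>E. indicat_real K \<omega> * (cmod (cinner e (F \<omega>)))\<^sup>2))"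
      by (intro Bochner_Integration.integral_sum[symmetric] int)
    also have "\<dots> \<le> (LINT \<omega>|\<mu>. indicat_real K \<omega> * M\<^sup>2)"
    proof (rule integral_mono_AE)
      show "AE \<omega> in \<mu>. (\<Sum>e\<in>E. indicat_real K \<omega> * (cmod (cinner e (F \<omega>)))\<^sup>2)
          \<le> indicat_real K \<omega> * M\<^sup>2"
        using M
      proof eventually_elim
        case (elim \<omega>)
        have "(\<Sum>e\<in>E. (cmod (cinner e (F \<omega>)))\<^sup>2) \<le> (norm (F \<omega>))\<^sup>2"
          using bessel_inequality[OF E, of "F \<omega>"] by (simp only: cmod_cinner_commute[of "F \<omega>"])
        also have "\<dots> \<le> M\<^sup>2" using elim by (simp add: power_mono)
        finally show ?case
          unfolding sum_distrib_left[symmetric] by (intro mult_left_mono) auto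
      qed
    qed (use K int in \<open>auto intro!: Bochner_Integration.integrable_sum\<close>)
    finally show ?thesis .
  qed
  show ?thesis
    using small_off_finite_orthonormal_set[of q, OF hom trace \<open>\<delta> > 0\<close>] that
    unfolding q_def by blast
qed

text \<open>
  The integral is split at a set \<open>K\<close> of finite measure off which the symbol is at most \<open>\<eta>\<close>.
  Off \<open>K\<close> the Bessel bounds give a factor \<open>\<eta>\<close>; on \<open>K\<close> the symbol is merely bounded, but the
  coefficients of \<open>f\<close> are small in \<open>L\<^sup>2(K)\<close> when \<open>f\<close> is orthogonal to \<open>E\<close>.
\<close>
lemma multiplier_form_small_off_finite_orthonormal_set:
  assumes F: "bessel_mapping_with_bound \<mu> F B\<^sub>F" and G: "bessel_mapping_with_bound \<mu> G B\<^sub>G"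
    and "norm_bounded \<mu> F"
    and m: "m \<in> borel_measurable \<mu>" "essentially_bounded \<mu> m" "vanishes_at_infinity \<mu> m"
    and "\<epsilon> > 0"
  shows "\<exists>E. finite E \<and> orthonormal_set E \<and> (\<forall>f g. orthogonal_to E f \<longrightarrow>
    cmod (LINT \<omega>|\<mu>. m \<omega> * cinner f (F \<omega>) * cinner (G \<omega>) g) \<le> \<epsilon> * norm f * norm g)"
proof -
  obtain M where M: "AE \<omega> in \<mu>. norm (F \<omega>) \<le> M"
    using \<open>norm_bounded \<mu> F\<close> by (auto simp: norm_bounded_def)
  obtain C' where C': "AE \<omega> in \<mu>. cmod (m \<omega>) \<le> C'"
    using m(2) by (auto simp: essentially_bounded_def)
  define C where "C = max 0 C'"
  have C: "AE \<omega> in \<mu>. cmod (m \<omega>) \<le> C" "0 \<le> C"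
    using C' by (auto simp: C_def)
  have B: "0 \<le> B\<^sub>F" "0 \<le> B\<^sub>G" using F G by (auto simp: bessel_mapping_with_bound_def)
  (* Each of the two parts of the integral is to contribute \<epsilon> / 2; the summands 1 in the
     denominators cover vanishing Bessel bounds. *)
  define \<eta> where "\<eta> = \<epsilon> / (2 * (sqrt B\<^sub>F * sqrt B\<^sub>G + 1))"
  define \<delta> where "\<delta> = \<epsilon> / (2 * (C * sqrt B\<^sub>G + 1))"
  have pos: "0 < sqrt B\<^sub>F * sqrt B\<^sub>G + 1" "0 < C * sqrt B\<^sub>G + 1"
    using B C(2) by (simp_all add: add_nonneg_pos)
  have "\<eta> > 0" "\<delta> > 0"
    using pos \<open>\<epsilon> > 0\<close> by (simp_all add: \<eta>_def \<delta>_def)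
  have \<eta>: "\<eta> * (sqrt B\<^sub>F * sqrt B\<^sub>G) \<le> \<epsilon> / 2"
    using pos(1) \<open>\<epsilon> > 0\<close> by (simp add: \<eta>_def field_simps)
  have \<delta>: "C * \<delta> * sqrt B\<^sub>G \<le> \<epsilon> / 2"
    using pos(2) \<open>\<epsilon> > 0\<close> by (simp add: \<delta>_def field_simps)
  obtain K where K: "K \<in> sets \<mu>" "emeasure \<mu> K < \<infinity>"
    and off_K: "AE \<omega> in \<mu>. \<omega> \<notin> K \<longrightarrow> cmod (m \<omega>) \<le> \<eta>"
    using m(3) \<open>\<eta> > 0\<close> by (auto simp: vanishes_at_infinity_def)
  obtain E where E: "finite E" "orthonormal_set E" and
    small: "\<And>f. orthogonal_to E f \<Longrightarrow>
      sqrt (LINT \<omega>|\<mu>. indicat_real K \<omega> * (cmod (cinner f (F \<omega>)))\<^sup>2) \<le> \<delta> * norm f"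
    by (rule bounded_bessel_mapping_small_off_finite_orthonormal_set[OF F M K \<open>\<delta> > 0\<close>]) blast
  have "cmod (LINT \<omega>|\<mu>. m \<omega> * cinner f (F \<omega>) * cinner (G \<omega>) g) \<le> \<epsilon> * norm f * norm g"
    if f: "orthogonal_to E f" for f g
  proof -
    define a where "a \<omega> = indicator K \<omega> * cinner f (F \<omega>)" for \<omega>
    define n where "n \<omega> = indicator (- K) \<omega> * m \<omega>" for \<omega>
    have [measurable]: "m \<in> borel_measurable \<mu>" "K \<in> sets \<mu>" by fact+
    note [measurable] = bessel_coefficient_measurable(1)[OF F]
    have am: "a \<in> borel_measurable \<mu>" unfolding a_def by measurable
    have nm: "n \<in> borel_measurable \<mu>"
    proof -
      have "(\<lambda>\<omega>. m \<omega> - indicator K \<omega> * m \<omega>) \<in> borel_measurable \<mu>" by measurable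
      also have "(\<lambda>\<omega>. m \<omega> - indicator K \<omega> * m \<omega>) = n"
        by (auto simp: n_def indicator_def)
      finally show ?thesis .
    qed
    have a2: "(cmod (a \<omega>))\<^sup>2 = indicat_real K \<omega> * (cmod (cinner f (F \<omega>)))\<^sup>2" for \<omega>
      by (simp add: a_def indicator_def)
    have a_int: "integrable \<mu> (\<lambda>\<omega>. (cmod (a \<omega>))\<^sup>2)"
      unfolding a2
      using integrable_mult_indicator[OF K(1) bessel_coefficient_square_integrable(1)[OF F]] by simp
    have n_le: "AE \<omega> in \<mu>. cmod (n \<omega>) \<le> \<eta>"
      using off_K by eventually_elim (use \<open>\<eta> > 0\<close> in \<open>auto simp: n_def indicator_def\<close>)
    note inner = Cauchy_Schwarz_weighted_integral[OF m(1) am bessel_coefficient_measurable(2)[OF G] a_int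
      bessel_coefficient_square_integrable(1)[OF G, of g, unfolded cmod_cinner_commute[of g]] C]
    note outer = multiplier_integrand_bound[OF F G nm n_le less_imp_le[OF \<open>\<eta> > 0\<close>], of f g]
    have "(LINT \<omega>|\<mu>. m \<omega> * cinner f (F \<omega>) * cinner (G \<omega>) g)
        = (LINT \<omega>|\<mu>. m \<omega> * a \<omega> * cinner (G \<omega>) g + n \<omega> * cinner f (F \<omega>) * cinner (G \<omega>) g)"
      by (intro Bochner_Integration.integral_cong refl) (auto simp: a_def n_def indicator_def)
    also have "\<dots> = (LINT \<omega>|\<mu>. m \<omega> * a \<omega> * cinner (G \<omega>) g)
        + (LINT \<omega>|\<mu>. n \<omega> * cinner f (F \<omega>) * cinner (G \<omega>) g)"
      by (rule Bochner_Integration.integral_add[OF inner(1) outer(1)])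
    finally have split: "cmod (LINT \<omega>|\<mu>. m \<omega> * cinner f (F \<omega>) * cinner (G \<omega>) g)
        \<le> cmod (LINT \<omega>|\<mu>. m \<omega> * a \<omega> * cinner (G \<omega>) g)
          + cmod (LINT \<omega>|\<mu>. n \<omega> * cinner f (F \<omega>) * cinner (G \<omega>) g)"
      by (simp only: norm_triangle_ineq)
    have "cmod (LINT \<omega>|\<mu>. m \<omega> * a \<omega> * cinner (G \<omega>) g)
        \<le> C * (\<delta> * norm f) * (sqrt B\<^sub>G * norm g)"
    proof (rule order_trans[OF inner(2)], intro mult_mono mult_left_mono mult_nonneg_nonneg)
      show "sqrt (LINT \<omega>|\<mu>. (cmod (a \<omega>))\<^sup>2) \<le> \<delta> * norm f"
        unfolding a2 by (rule small[OF f])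
      show "sqrt (LINT \<omega>|\<mu>. (cmod (cinner (G \<omega>) g))\<^sup>2) \<le> sqrt B\<^sub>G * norm g"
        unfolding cmod_cinner_commute[of _ g] by (rule sqrt_bessel_integral_le[OF G])
    qed (use \<open>\<delta> > 0\<close> C(2) in auto)
    also have "\<dots> = C * \<delta> * sqrt B\<^sub>G * (norm f * norm g)" by (simp add: mult_ac)
    also have "\<dots> \<le> \<epsilon> / 2 * (norm f * norm g)" by (intro mult_right_mono \<delta>) simp
    finally have 1: "cmod (LINT \<omega>|\<mu>. m \<omega> * a \<omega> * cinner (G \<omega>) g) \<le> \<epsilon> / 2 * (norm f * norm g)" .
    have "\<eta> * (sqrt B\<^sub>F * sqrt B\<^sub>G) * (norm f * norm g) \<le> \<epsilon> / 2 * (norm f * norm g)"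
      by (intro mult_right_mono \<eta>) simp
    with outer(2) have 2: "cmod (LINT \<omega>|\<mu>. n \<omega> * cinner f (F \<omega>) * cinner (G \<omega>) g)
        \<le> \<epsilon> / 2 * (norm f * norm g)"
      by (simp add: mult.assoc)
    have "\<epsilon> * norm f * norm g = \<epsilon> / 2 * (norm f * norm g) + \<epsilon> / 2 * (norm f * norm g)"
      by (simp add: field_simps)
    with split 1 2 show ?thesis by linarith
  qed
  with E show ?thesis by blast
qed

text \<open>
  The adjoint of a multiplier is the multiplier with conjugate symbol and exchanged mappings, so
  estimates in \<open>F\<close> carry over to \<open>G\<close>.
\<close>
lemma cnj_multiplier_form:
  "cnj (LINT \<omega>|\<mu>. m \<omega> * cinner f (F \<omega>) * cinner (G \<omega>) g)
    = (LINT \<omega>|\<mu>. cnj (m \<omega>) * cinner g (G \<omega>) * cinner (F \<omega>) f)"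
proof -
  have "cnj (m \<omega> * cinner f (F \<omega>) * cinner (G \<omega>) g)
      = cnj (m \<omega>) * cinner g (G \<omega>) * cinner (F \<omega>) f" for \<omega>
    using cinner_commute[of "F \<omega>" f] cinner_commute[of g "G \<omega>"] by simp
  then show ?thesis
    by (simp only: Bochner_Integration.integral_cnj[symmetric])
qed

lemma bessel_multiplier_weakly_defined:
  fixes F G :: "'w \<Rightarrow> 'h::complex_hilbert_space"
  assumes F: "bessel_mapping_with_bound \<mu> F B\<^sub>F" and G: "bessel_mapping_with_bound \<mu> G B\<^sub>G"
    and m: "m \<in> borel_measurable \<mu>" "AE \<omega> in \<mu>. cmod (m \<omega>) \<le> C" "0 \<le> C"
  shows "weakly_defines_multiplier \<mu> m F G (bessel_multiplier \<mu> m F G)"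
proof -
  define \<Phi> where "\<Phi> f g = (LINT \<omega>|\<mu>. m \<omega> * cinner f (F \<omega>) * cinner (G \<omega>) g)" for f g
  have add: "\<Phi> f (g + h) = \<Phi> f g + \<Phi> f h" for f g h
    using multiplier_integrand_bound(1)[OF F G m]
    by (simp add: \<Phi>_def cinner_add_right distrib_left)
  have scale: "\<Phi> f (scaleC c g) = cnj c * \<Phi> f g" for c f g
    by (simp add: \<Phi>_def cinner_scaleC_right mult.left_commute flip: integral_mult_right_zero)
  have bnd: "cmod (\<Phi> f g) \<le> (C * (sqrt B\<^sub>F * sqrt B\<^sub>G) * norm f) * norm g" for f g
    unfolding \<Phi>_def by (rule multiplier_integrand_bound(2)[OF F G m])
  have "\<exists>y. \<forall>g. cinner y g = \<Phi> f g" for f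
    by (rule riesz_conjugate_linear_functional[OF add scale bnd])
  then obtain T where "\<forall>f g. cinner (T f) g = \<Phi> f g" by metis
  then have "weakly_defines_multiplier \<mu> m F G T"
    by (simp add: weakly_defines_multiplier_def \<Phi>_def)
  from this bessel_multiplier_eqI[OF this] show ?thesis by simp
qed

theorem corollary3p8:
  fixes \<mu> :: "'w measure"
    and F G :: "'w \<Rightarrow> 'h::complex_hilbert_space"
    and m :: "'w \<Rightarrow> complex"
  assumes "bessel_mapping \<mu> F"
    and "bessel_mapping \<mu> G"
    and "norm_bounded \<mu> F \<or> norm_bounded \<mu> G"
    and "m \<in> borel_measurable \<mu>"
    and "essentially_bounded \<mu> m"
    and "vanishes_at_infinity \<mu> m"
  shows "compact_operator (bessel_multiplier \<mu> m F G)"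
proof -
  from assms(1) obtain B\<^sub>F where F: "bessel_mapping_with_bound \<mu> F B\<^sub>F"
    unfolding bessel_mapping_def ..
  from assms(2) obtain B\<^sub>G where G: "bessel_mapping_with_bound \<mu> G B\<^sub>G"
    unfolding bessel_mapping_def ..
  obtain C where "AE \<omega> in \<mu>. cmod (m \<omega>) \<le> C"
    using assms(5) by (auto simp: essentially_bounded_def)
  then have C: "AE \<omega> in \<mu>. cmod (m \<omega>) \<le> max 0 C" "0 \<le> max 0 C"
    by auto
  let ?T = "bessel_multiplier \<mu> m F G"
  note bound = multiplier_integrand_bound[OF F G assms(4) C]
  have T: "cinner (?T f) g = (LINT \<omega>|\<mu>. m \<omega> * cinner f (F \<omega>) * cinner (G \<omega>) g)" for f g
    using bessel_multiplier_weakly_defined[OF F G assms(4) C] by (simp add: weakly_defines_multiplier_def)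
  show ?thesis
  proof (rule compact_operator_if_small_off_finite_orthonormal_sets)
    show "?T (f + h) = ?T f + ?T h" for f h
    proof (rule cinner_left_ext)
      fix g
      show "cinner (?T (f + h)) g = cinner (?T f + ?T h) g"
        using bound(1) by (simp add: T cinner_add_left distrib_left distrib_right)
    qed
    show "?T (scaleC c f) = scaleC c (?T f)" for c f
      by (rule cinner_left_ext)
        (simp add: T cinner_scaleC_left mult_ac flip: integral_mult_right_zero)
    show "cmod (cinner (?T f) g) \<le> max 0 C * (sqrt B\<^sub>F * sqrt B\<^sub>G) * norm f * norm g" for f g
      unfolding T by (rule bound(2))
    fix \<epsilon> :: real assume "\<epsilon> > 0"
    from assms(3) show "\<exists>E. finite E \<and> orthonormal_set E \<and>
      ((\<forall>f g. orthogonal_to E f \<longrightarrow> cmod (cinner (?T f) g) \<le> \<epsilon> * norm f * norm g) \<or>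
       (\<forall>f g. orthogonal_to E g \<longrightarrow> cmod (cinner (?T f) g) \<le> \<epsilon> * norm f * norm g))"
    proof
      assume "norm_bounded \<mu> F"
      from multiplier_form_small_off_finite_orthonormal_set[OF F G this assms(4-6) \<open>\<epsilon> > 0\<close>]
      show ?thesis unfolding T by blast
    next
      assume nb: "norm_bounded \<mu> G"
      have "(\<lambda>\<omega>. cnj (m \<omega>)) \<in> borel_measurable \<mu>" "essentially_bounded \<mu> (\<lambda>\<omega>. cnj (m \<omega>))"
        "vanishes_at_infinity \<mu> (\<lambda>\<omega>. cnj (m \<omega>))"
        using borel_measurable_cnj[OF assms(4)] assms(5,6)
        by (simp_all only: essentially_bounded_def vanishes_at_infinity_def complex_mod_cnj)
      from multiplier_form_small_off_finite_orthonormal_set[OF G F nb this \<open>\<epsilon> > 0\<close>]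
      obtain E where E: "finite E" "orthonormal_set E"
        "\<forall>g f. orthogonal_to E g \<longrightarrow>
          cmod (LINT \<omega>|\<mu>. cnj (m \<omega>) * cinner g (G \<omega>) * cinner (F \<omega>) f) \<le> \<epsilon> * norm g * norm f"
        by (elim exE conjE)
      have "cmod (cinner (?T f) g) \<le> \<epsilon> * norm f * norm g" if "orthogonal_to E g" for f g
      proof -
        have "cmod (cinner (?T f) g) = cmod (cnj (cinner (?T f) g))" by simp
        also have "\<dots> \<le> \<epsilon> * norm g * norm f"
          unfolding T cnj_multiplier_form by (rule E(3)[rule_format, OF that])
        finally show ?thesis by (simp add: mult_ac)
      qed
      with E(1,2) show ?thesis by blast
    qed
  qed
qed

end
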